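(* Let $q$ be an odd prime power, let $b,d\in\mathbb{F}_{q^2}$ with $b\neq 0$, and let $\alpha$ be a primitive element of $\mathbb{F}_{q^2}$. Then the number of zeros of $x^q+bx^2+d$ in $\mathbb{F}_{q^2}$ is $$1-\eta(-b^{q+1})\sum_{i\in K}(-1)^i,$$ where $K=\{\,i\in\mathbb{Z} : 0\le i\le q,\ h(\alpha^{i(q-1)})=0\,\}$ and $$h(x)=b^qx^3-4b^{q+1}d^qx^2-4b^{q+1}d\,x+b.$$
   Context: $\mathbb{F}_q\subset\mathbb{F}_{q^2}$ are the finite fields with $q$ and $q^2$ elements; a primitive element of $\mathbb{F}_{q^2}$ is a generator of the cyclic group $\mathbb{F}_{q^2}^*$. $\eta$ is the quadratic character of $\mathbb{F}_q^*$ (value $1$ on nonzero squares of $\mathbb{F}_q$, $-1$ on nonsquares); note $b^{q+1}\in\mathbb{F}_q^*$. Zeros are counted as distinct elements of $\mathbb{F}_{q^2}$. *)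

theory Defs
  imports "HOL-Number_Theory.Number_Theory" "HOL-Library.Cardinality"
begin

definition is_subfield :: "'a::field set \<Rightarrow> bool" where
  "is_subfield F \<longleftrightarrow> 0 \<in> F \<and> 1 \<in> F \<and>
     (\<forall>x\<in>F. \<forall>y\<in>F. x + y \<in> F \<and> x * y \<in> F) \<and>
     (\<forall>x\<in>F. - x \<in> F \<and> inverse x \<in> F)"

definition primitive_element :: "'a::field \<Rightarrow> bool" where
  "primitive_element a \<longleftrightarrow> a \<noteq> 0 \<and> {a powi k |k :: int. True} = UNIV - {0}"

(* The quadratic character of the group of nonzero elements of F; its value is only
   meaningful for x in F - {0}. Squares are those of elements of F, not of the ambient field
   (for a finite field and its quadratic extension, every element of F is a square upstairs). *)
definition quadratic_character :: "'a::field set \<Rightarrow> 'a \<Rightarrow> int" where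
  "quadratic_character F x = (if \<exists>y\<in>F. x = y ^ 2 then 1 else - 1)"

definition h_poly :: "nat \<Rightarrow> 'a::field \<Rightarrow> 'a \<Rightarrow> 'a \<Rightarrow> 'a" where
  "h_poly q b d x =
     b ^ q * x ^ 3 - 4 * b ^ (q + 1) * d ^ q * x ^ 2 - 4 * b ^ (q + 1) * d * x + b"

end

theory Submission
  imports Defs "HOL-Computational_Algebra.Polynomial"
begin

text \<open>
  Write \<open>f x = x ^ q + b * x ^ 2 + d\<close> and let \<open>tr x = x + x ^ q\<close> be the trace from the field with
  \<open>q ^ 2\<close> elements to its subfield \<open>F\<close> with \<open>q\<close> elements. Over \<open>F\<close> the equation \<open>f x = 0\<close> is a
  pair of quadratic equations in two unknowns, so its solutions are the common points of the
  pencil of affine conics \<open>C i = {x. tr (\<alpha> ^ i * f x) = 0}\<close> with \<open>0 \<le> i \<le> q\<close>; these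
  \<open>\<alpha> ^ i\<close> represent the nonzero elements modulo those of \<open>F\<close>. A zero of \<open>f\<close> lies on all \<open>q + 1\<close>
  members and any other point lies on exactly one of them, because the elements of trace
  \<open>0\<close> form a single line over \<open>F\<close>. Counting incidences, the sizes of the \<open>C i\<close> sum to
  \<open>q ^ 2 + q * N\<close>, where \<open>N\<close> is the number of zeros.

  The size of each conic is explicit. With \<open>\<kappa> = \<alpha> ^ i\<close> and \<open>\<mu> = \<kappa> * b\<close>, completing the square
  turns the equation of \<open>C i\<close> into \<open>tr (\<mu> * z ^ 2) = c\<close> for some \<open>c\<close> in \<open>F\<close>. The binary quadratic
  form on the left is nondegenerate, and it is hyperbolic or anisotropic according to the class of
  \<open>\<mu>\<close> modulo squares, that is, according to the parity of its exponent. With a sign \<open>\<epsilon> i\<close> that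
  is \<open>1\<close> in the hyperbolic case and \<open>-1\<close> otherwise, the conic has \<open>q - \<epsilon> i\<close> points, and
  \<open>q * \<epsilon> i\<close> more if \<open>c = 0\<close> (lemma \<open>card_trace_form_fibre\<close>). Up to a nonzero factor, \<open>c\<close>
  is the cubic \<open>h\<close> at \<open>\<alpha> ^ (i * (q - 1))\<close>, which is thus the discriminant of the pencil.

  The signs \<open>\<epsilon> i\<close> alternate with \<open>i\<close>, so they cancel in the sum over the \<open>q + 1\<close> members, and
  \<open>N = 1 + (\<Sum>i\<in>K. \<epsilon> i)\<close> remains. Finally \<open>\<epsilon> i = - \<eta> (- b ^ (q + 1)) * (- 1) ^ i\<close>, because both
  characters can be read off from the exponent of \<open>b\<close>
  (lemma \<open>quadratic_character_minus_norm\<close>).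
\<close>

section \<open>Arithmetic in a quadratic extension of finite fields\<close>

locale quadratic_extension =
  fixes q r :: nat and F :: "'a::{field,finite} set" and \<alpha> :: 'a
  assumes primepow_q: "primepow q" and q_eq: "q = 2 * r + 1"
    and card_UNIV: "CARD('a) = q ^ 2"
    and subfield: "is_subfield F" and card_F: "card F = q"
    and primitive: "primitive_element \<alpha>"
begin

lemma odd_q: "odd q"
  by (simp add: q_eq)

lemma r_pos: "r > 0"
  using primepow_gt_Suc_0[OF primepow_q] q_eq by simp

lemma card_units: "q ^ 2 - 1 = 4 * r * (r + 1)"
  by (simp add: q_eq power2_eq_square algebra_simps)

lemma card_units_pos: "q ^ 2 - 1 > 0"
  unfolding card_units using r_pos by simp

lemma alpha_nonzero [simp]: "\<alpha> \<noteq> 0"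
  using primitive by (simp add: primitive_element_def)

text \<open>The characteristic divides \<open>q ^ 2\<close>, so the prime power \<open>q\<close> is a power of it.\<close>

lemma q_power_CHAR: "\<exists>n. prime CHAR('a) \<and> q = CHAR('a) ^ n"
proof -
  have pr: "prime CHAR('a)"
    using finite_imp_CHAR_pos[where ?'a = 'a] prime_CHAR_semidom[where ?'a = 'a] by simp
  obtain p n where p: "prime p" "q = p ^ n"
    using primepow_q by (auto simp: primepow_def)
  have "CHAR('a) dvd q ^ 2"
    using CHAR_dvd_CARD[where ?'a = 'a] by (simp add: card_UNIV)
  hence "CHAR('a) dvd p"
    using pr p by (metis prime_dvd_power)
  hence "CHAR('a) = p"
    using pr p by (simp add: primes_dvd_imp_eq)
  thus ?thesis using pr p by blast
qed

lemma frobenius_add: "(x + y :: 'a) ^ q = x ^ q + y ^ q"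
  using q_power_CHAR freshmans_dream' by blast

lemma frobenius_minus: "(- x :: 'a) ^ q = - (x ^ q)"
  using odd_q by simp

lemma frobenius_diff: "(x - y :: 'a) ^ q = x ^ q - y ^ q"
  using frobenius_add[of x "- y"] by (simp add: frobenius_minus)

lemma power_card_units: "(x :: 'a) \<noteq> 0 \<Longrightarrow> x ^ (q ^ 2 - 1) = 1"
proof -
  assume x: "x \<noteq> 0"
  have "(\<Prod>y\<in>UNIV - {0}. x * y) = (\<Prod>y\<in>UNIV - {0}. y)"
    by (rule prod.reindex_bij_witness[of _ "\<lambda>y. y / x" "\<lambda>y. x * y"]) (use x in auto)
  moreover have "(\<Prod>y\<in>UNIV - {0}. x * y) = x ^ card (UNIV - {0 :: 'a}) * (\<Prod>y\<in>UNIV - {0}. y)"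
    by (simp add: prod.distrib)
  moreover have "(\<Prod>y\<in>UNIV - {0 :: 'a}. y) \<noteq> 0" by simp
  ultimately show ?thesis
    by (simp add: card_UNIV card_Diff_singleton)
qed

lemma frobenius_frobenius [simp]: "((x :: 'a) ^ q) ^ q = x"
proof (cases "x = 0")
  case False
  have "(x ^ q) ^ q = x ^ Suc (q ^ 2 - 1)"
    using odd_q by (simp add: power2_eq_square odd_pos flip: power_mult)
  also have "\<dots> = x" using power_card_units[OF False] by simp
  finally show ?thesis .
qed (use odd_q odd_pos in auto)

text \<open>Multiplication by a unit of \<open>F\<close> permutes the \<open>q - 1\<close> units of \<open>F\<close>, so \<open>F\<close> is contained in the
  fixed field of the Frobenius map; the two agree because \<open>x ^ q - x\<close> has no more than \<open>q\<close>
  roots.\<close>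

lemma mem_F_iff: "x \<in> F \<longleftrightarrow> x ^ q = x"
proof -
  have sub: "F \<subseteq> {x. x ^ q = x}"
  proof
    fix x assume x: "x \<in> F"
    show "x \<in> {x. x ^ q = x}"
    proof (cases "x = 0")
      case False
      have "(\<Prod>y\<in>F - {0}. x * y) = (\<Prod>y\<in>F - {0}. y)"
        by (rule prod.reindex_bij_witness[of _ "\<lambda>y. inverse x * y" "\<lambda>y. x * y"])
           (use False x subfield in \<open>auto simp: is_subfield_def\<close>)
      moreover have "(\<Prod>y\<in>F - {0}. x * y) = x ^ card (F - {0}) * (\<Prod>y\<in>F - {0}. y)"
        by (simp add: prod.distrib)
      moreover have "(\<Prod>y\<in>F - {0}. y) \<noteq> 0" by simp
      moreover have "card (F - {0}) = q - 1"
        using subfield card_F by (simp add: is_subfield_def card_Diff_singleton)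
      ultimately have "x ^ (q - 1) = 1" by simp
      moreover have "x ^ q = x * x ^ (q - 1)"
        using odd_q by (simp add: odd_pos flip: power_Suc)
      ultimately show ?thesis by simp
    qed (use odd_q odd_pos in auto)
  qed
  let ?p = "monom 1 q - monom 1 1 :: 'a poly"
  have "q > 1" using q_eq r_pos by simp
  hence deg: "coeff ?p q = 1" "degree ?p \<le> q"
    by (auto intro!: degree_diff_le simp: degree_monom_eq)
  have "?p \<noteq> 0" using deg(1) by (metis coeff_0 zero_neq_one)
  hence "card {x. poly ?p x = 0} \<le> q"
    using card_poly_roots_bound[of ?p] deg(2) by linarith
  hence "card {x :: 'a. x ^ q = x} \<le> card F"
    by (simp add: poly_monom card_F)
  with sub have "F = {x. x ^ q = x}"
    by (intro card_seteq) auto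
  thus ?thesis by blast
qed

lemma frobenius_square: "((x :: 'a) ^ 2) ^ q = (x ^ q) ^ 2"
  by (simp add: mult.commute flip: power_mult)

lemma frobenius_two: "(2 :: 'a) ^ q = 2"
  using frobenius_add[of 1 1] by simp

lemma discrete_log:
  assumes "(x :: 'a) \<noteq> 0"
  obtains k where "k < q ^ 2 - 1" "x = \<alpha> ^ k"
proof -
  obtain k :: int where k: "x = \<alpha> powi k"
    using primitive assms unfolding primitive_element_def by blast
  let ?N = "int (q ^ 2 - 1)"
  have N: "?N > 0" using card_units_pos by linarith
  have "\<alpha> powi k = \<alpha> powi (?N * (k div ?N) + k mod ?N)" by simp
  also have "\<dots> = (\<alpha> powi ?N) powi (k div ?N) * \<alpha> powi (k mod ?N)"
    by (subst power_int_add) (auto simp: power_int_mult)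
  also have "\<alpha> powi ?N = 1"
    using power_card_units[of \<alpha>] by (simp only: power_int_of_nat) simp
  also have "\<alpha> powi (k mod ?N) = \<alpha> ^ nat (k mod ?N)"
    using pos_mod_sign[OF N] by (simp only: power_int_def if_True)
  finally have "x = \<alpha> ^ nat (k mod ?N)" using k by simp
  moreover have "nat (k mod ?N) < q ^ 2 - 1"
    using pos_mod_sign[OF N] pos_mod_bound[OF N] by (simp only: nat_less_iff)
  ultimately show ?thesis using that by blast
qed

lemma alpha_power_eq_1_iff: "\<alpha> ^ k = 1 \<longleftrightarrow> q ^ 2 - 1 dvd k"
proof
  let ?N = "q ^ 2 - 1"
  have N: "?N > 0" using card_units_pos by linarith
  have "x \<in> (\<lambda>k. \<alpha> ^ k) ` {..<?N}" if "x \<noteq> 0" for x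
    using discrete_log[OF that] by blast
  hence img: "(\<lambda>k. \<alpha> ^ k) ` {..<?N} = UNIV - {0}"
    by auto
  have "card ((\<lambda>k. \<alpha> ^ k) ` {..<?N}) = card {..<?N}"
    unfolding img by (simp add: card_UNIV card_Diff_singleton)
  hence inj: "inj_on (\<lambda>k. \<alpha> ^ k) {..<?N}"
    by (rule eq_card_imp_inj_on[rotated]) simp
  assume "\<alpha> ^ k = 1"
  moreover have "\<alpha> ^ k = (\<alpha> ^ ?N) ^ (k div ?N) * \<alpha> ^ (k mod ?N)"
    by (simp only: mult_div_mod_eq flip: power_mult power_add)
  ultimately have "\<alpha> ^ (k mod ?N) = \<alpha> ^ 0"
    by (simp only: power_card_units[OF alpha_nonzero] power_one mult_1 power_0)
  hence "k mod ?N = 0"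
    by (rule inj_onD[OF inj]) (use N in simp_all)
  thus "?N dvd k" by (simp only: dvd_eq_mod_eq_0)
next
  assume "q ^ 2 - 1 dvd k"
  then obtain c where "k = (q ^ 2 - 1) * c" by (elim dvdE)
  thus "\<alpha> ^ k = 1"
    by (simp only: power_mult power_card_units[OF alpha_nonzero] power_one)
qed

text \<open>The exponent is half the order of \<open>\<alpha>\<close>.\<close>

lemma alpha_power_minus_1: "\<alpha> ^ (2 * r * (r + 1)) = - 1"
proof -
  have "(\<alpha> ^ (2 * r * (r + 1))) ^ 2 = \<alpha> ^ (q ^ 2 - 1)"
    by (simp only: card_units flip: power_mult) (simp add: algebra_simps)
  hence "(\<alpha> ^ (2 * r * (r + 1))) ^ 2 = 1"
    using power_card_units[of \<alpha>] by simp
  moreover have "\<alpha> ^ (2 * r * (r + 1)) \<noteq> 1"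
    unfolding alpha_power_eq_1_iff card_units using r_pos by (auto dest!: dvd_imp_le)
  ultimately show ?thesis by (simp only: power2_eq_1_iff) simp
qed

lemma two_nonzero: "(2 :: 'a) \<noteq> 0"
proof
  assume "(2 :: 'a) = 0"
  hence "(- 1 :: 'a) = 1"
    by (metis add_eq_0_iff one_add_one)
  hence "\<alpha> ^ (2 * r * (r + 1)) = 1"
    by (simp only: alpha_power_minus_1)
  thus False
    unfolding alpha_power_eq_1_iff card_units using r_pos by (auto dest!: dvd_imp_le)
qed

lemma alpha_power_mem_F_iff: "\<alpha> ^ k \<in> F \<longleftrightarrow> q + 1 dvd k"
proof -
  have "(\<alpha> ^ k) ^ q = \<alpha> ^ k * \<alpha> ^ (k * (2 * r))"
    by (simp add: q_eq algebra_simps flip: power_mult power_add)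
  hence "\<alpha> ^ k \<in> F \<longleftrightarrow> \<alpha> ^ (k * (2 * r)) = 1"
    by (simp add: mem_F_iff)
  also have "\<dots> \<longleftrightarrow> (q + 1) * (2 * r) dvd k * (2 * r)"
    unfolding alpha_power_eq_1_iff card_units by (simp add: q_eq algebra_simps)
  also have "\<dots> \<longleftrightarrow> q + 1 dvd k"
    using r_pos by (simp only: mult.commute[of _ "2 * r"] nat_mult_dvd_cancel_disj) simp
  finally show ?thesis .
qed

section \<open>The trace and its kernel\<close>

definition tr :: "'a \<Rightarrow> 'a" where "tr x = x + x ^ q"

text \<open>The square root \<open>\<tau>\<close> of the generator \<open>\<alpha> ^ (q + 1)\<close> of the unit group of \<open>F\<close> is moved
  to \<open>- \<tau>\<close> by the Frobenius map, so it spans the kernel of the trace over \<open>F\<close>.\<close>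

definition \<tau> :: 'a where "\<tau> = \<alpha> ^ (r + 1)"

lemma tau_nonzero [simp]: "\<tau> \<noteq> 0"
  by (simp add: \<tau>_def)

lemma frobenius_tau: "\<tau> ^ q = - \<tau>"
proof -
  have "\<tau> ^ q = \<tau> * \<alpha> ^ (2 * r * (r + 1))"
    by (simp add: \<tau>_def q_eq algebra_simps flip: power_mult power_add)
  thus ?thesis by (simp only: alpha_power_minus_1) simp
qed

lemma tr_in_F: "tr x \<in> F"
  by (simp add: mem_F_iff tr_def frobenius_add add.commute)

lemma tr_eq_0_iff: "tr x = 0 \<longleftrightarrow> \<tau> * x \<in> F"
proof -
  have "\<tau> * x \<in> F \<longleftrightarrow> - (\<tau> * x ^ q) = \<tau> * x"
    by (simp add: mem_F_iff power_mult_distrib frobenius_tau)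
  also have "\<dots> \<longleftrightarrow> \<tau> * tr x = 0"
    by (simp only: neg_eq_iff_add_eq_0 tr_def distrib_left add.commute)
  finally show ?thesis by simp
qed

text \<open>The powers \<open>\<alpha> ^ i\<close> with \<open>i \<le> q\<close> represent the units modulo those of \<open>F\<close>, so exactly one of
  them moves a given unit into the kernel of the trace.\<close>

lemma card_trace_killers:
  assumes "(v :: 'a) \<noteq> 0"
  shows "card {i. i \<le> q \<and> tr (\<alpha> ^ i * v) = 0} = 1"
proof -
  obtain s where "\<tau> * v = \<alpha> ^ s"
    using discrete_log[of "\<tau> * v"] assms by auto
  hence "tr (\<alpha> ^ i * v) = 0 \<longleftrightarrow> \<alpha> ^ (i + s) \<in> F" for i
    unfolding tr_eq_0_iff by (simp add: power_add mult.left_commute)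
  hence iff: "tr (\<alpha> ^ i * v) = 0 \<longleftrightarrow> q + 1 dvd i + s" for i
    by (simp add: alpha_power_mem_F_iff)
  \<comment> \<open>The representative of \<open>- s\<close> modulo \<open>q + 1\<close>.\<close>
  define j where "j = (if s mod (q + 1) = 0 then 0 else q + 1 - s mod (q + 1))"
  have "i \<le> q \<and> q + 1 dvd i + s \<longleftrightarrow> i = j" for i
  proof -
    have "q + 1 dvd i + s \<longleftrightarrow> q + 1 dvd i + s mod (q + 1)"
      by (metis dvd_eq_mod_eq_0 mod_add_right_eq)
    moreover have lt: "s mod (q + 1) < q + 1" by simp
    moreover have "q + 1 dvd i + s mod (q + 1) \<longleftrightarrow> i + s mod (q + 1) \<in> {0, q + 1}" if "i \<le> q"
    proof
      assume "q + 1 dvd i + s mod (q + 1)"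
      then obtain c where c: "i + s mod (q + 1) = (q + 1) * c" by (elim dvdE)
      have "i + m < (q + 1) * 2" if "m < q + 1" for m
        using that \<open>i \<le> q\<close> by simp
      from this[OF lt] have "i + s mod (q + 1) < (q + 1) * 2" .
      hence "c < 2" unfolding c by (simp only: mult_less_cancel1)
      hence "c = 0 \<or> c = 1" by linarith
      thus "i + s mod (q + 1) \<in> {0, q + 1}" using c by auto
    qed auto
    ultimately show ?thesis unfolding j_def by auto
  qed
  hence "{i. i \<le> q \<and> tr (\<alpha> ^ i * v) = 0} = {j}"
    using iff by auto
  thus ?thesis by simp
qed

section \<open>Counting points on a central conic\<close>

text \<open>The norm \<open>s ^ (q + 1)\<close> maps the units onto those of \<open>F\<close>; in terms of exponents, the
  fibre over a unit is a coset of the multiples of \<open>q - 1\<close>.\<close>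

lemma card_norm_fibre:
  assumes "c \<in> F"
  shows "card {s. s ^ (q + 1) = c} = (if c = 0 then 1 else q + 1)"
proof (cases "c = 0")
  case True
  hence eq: "{s. s ^ (q + 1) = c} = {0}" by auto
  show ?thesis unfolding eq using True by simp
next
  case False
  obtain e where e: "c = \<alpha> ^ e" using discrete_log[OF False] .
  then obtain t where t: "e = (q + 1) * t"
    using assms by (auto simp: alpha_power_mem_F_iff elim!: dvdE)
  have c_eq: "c = (\<alpha> ^ t) ^ (q + 1)"
    unfolding e t by (subst mult.commute) (rule power_mult)
  have units: "(\<alpha> ^ k) ^ (q + 1) = 1 \<longleftrightarrow> 2 * r dvd k" for k
  proof -
    have "(\<alpha> ^ k) ^ (q + 1) = 1 \<longleftrightarrow> (2 * (r + 1)) * (2 * r) dvd (2 * (r + 1)) * k"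
      unfolding power_mult[symmetric] alpha_power_eq_1_iff card_units
      by (simp add: q_eq algebra_simps)
    thus ?thesis by (simp only: nat_mult_dvd_cancel_disj) simp
  qed
  have "{s. s ^ (q + 1) = c} = (\<lambda>i. \<alpha> ^ (t + 2 * r * i)) ` {..q}"
  proof (intro equalityI subsetI)
    fix s assume "s \<in> {s. s ^ (q + 1) = c}"
    hence s: "s ^ (q + 1) = (\<alpha> ^ t) ^ (q + 1)"
      by (simp only: mem_Collect_eq c_eq)
    hence "s \<noteq> 0" by auto
    then obtain k where k: "k < q ^ 2 - 1" "s / \<alpha> ^ t = \<alpha> ^ k"
      using discrete_log[of "s / \<alpha> ^ t"] by auto
    have "(\<alpha> ^ k) ^ (q + 1) = 1"
      unfolding k(2)[symmetric] power_divide s by simp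
    hence "2 * r dvd k" unfolding units .
    then obtain i where i: "k = 2 * r * i" by (elim dvdE)
    have "2 * r * i < 2 * r * (q + 1)"
      using k(1) unfolding i card_units by (simp add: q_eq algebra_simps)
    hence "i \<le> q" by (simp only: mult_less_cancel1) simp
    moreover have "s = \<alpha> ^ (t + 2 * r * i)"
      using k(2) by (simp add: i power_add field_simps)
    ultimately show "s \<in> (\<lambda>i. \<alpha> ^ (t + 2 * r * i)) ` {..q}" by blast
  next
    fix s assume "s \<in> (\<lambda>i. \<alpha> ^ (t + 2 * r * i)) ` {..q}"
    then obtain i where "s = \<alpha> ^ t * \<alpha> ^ (2 * r * i)"
      unfolding power_add by blast
    hence "s ^ (q + 1) = (\<alpha> ^ t) ^ (q + 1) * (\<alpha> ^ (2 * r * i)) ^ (q + 1)"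
      by (simp only: power_mult_distrib)
    also have "(\<alpha> ^ (2 * r * i)) ^ (q + 1) = 1" unfolding units by simp
    finally show "s \<in> {s. s ^ (q + 1) = c}"
      by (simp only: mem_Collect_eq c_eq mult_1_right)
  qed
  moreover have "inj_on (\<lambda>i. \<alpha> ^ (t + 2 * r * i)) {..q}"
  proof (rule linorder_inj_onI)
    fix i j assume ij: "i < j" "i \<in> {..q}" "j \<in> {..q}"
    show "\<alpha> ^ (t + 2 * r * i) \<noteq> \<alpha> ^ (t + 2 * r * j)"
    proof
      assume eq: "\<alpha> ^ (t + 2 * r * i) = \<alpha> ^ (t + 2 * r * j)"
      have "t + 2 * r * j = (t + 2 * r * i) + 2 * r * (j - i)"
        using ij by (simp add: diff_mult_distrib2)
      hence "\<alpha> ^ (2 * r * (j - i)) = 1"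
        using eq by (metis alpha_nonzero mult_cancel_left2 power_add power_not_zero)
      hence "2 * r * (q + 1) dvd 2 * r * (j - i)"
        unfolding alpha_power_eq_1_iff card_units by (simp add: q_eq algebra_simps)
      hence "q + 1 dvd j - i"
        using r_pos by (simp only: nat_mult_dvd_cancel_disj) simp
      thus False using ij by (auto dest!: dvd_imp_le)
    qed
  qed auto
  ultimately show ?thesis using False by (simp add: card_image)
qed

lemma card_hyperbola:
  assumes "c \<in> F"
  shows "card {(s, t). s \<in> F \<and> t \<in> F \<and> s * t = c} = (if c = 0 then 2 * q - 1 else q - 1)"
proof (cases "c = 0")
  case True
  have F0: "0 \<in> F" using subfield by (simp add: is_subfield_def)
  have "{(s, t). s \<in> F \<and> t \<in> F \<and> s * t = c} = F \<times> {0} \<union> {0} \<times> (F - {0})"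
    using True F0 by auto
  moreover have "card (F \<times> {0} \<union> {0 :: 'a} \<times> (F - {0 :: 'a})) = q + (q - 1)"
    using F0 by (subst card_Un_disjoint) (auto simp: card_cartesian_product card_F)
  ultimately show ?thesis using True q_eq by simp
next
  case False
  have div: "c / s \<in> F" if "s \<in> F" for s
    using that assms subfield unfolding is_subfield_def divide_inverse by blast
  have solve: "c / s = t" if "s * t = c" for s t
    using that False by auto
  have "bij_betw (\<lambda>s. (s, c / s)) (F - {0}) {(s, t). s \<in> F \<and> t \<in> F \<and> s * t = c}"
    by (rule bij_betwI[where g = fst]) (use False div solve in auto)
  hence "card {(s, t). s \<in> F \<and> t \<in> F \<and> s * t = c} = card (F - {0})"
    by (simp add: bij_betw_same_card)
  also have "\<dots> = q - 1"
    using subfield card_F by (simp add: is_subfield_def card_Diff_singleton)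
  finally show ?thesis using False by simp
qed

text \<open>If \<open>\<mu>\<close> equals \<open>\<tau>\<close> up to squares, then after scaling \<open>z\<close> the form is
  \<open>\<tau> * (y ^ 2 - (y ^ q) ^ 2)\<close>, the product of the two \<open>F\<close>-valued linear forms \<open>y + y ^ q\<close> and
  \<open>\<tau> * (y - y ^ q)\<close>, which are coordinates over \<open>F\<close>.\<close>

lemma card_trace_form_fibre_hyperbolic:
  assumes "\<mu> * w ^ 2 = \<tau>" and c: "c \<in> F"
  shows "card {z. tr (\<mu> * z ^ 2) = c} = (if c = 0 then 2 * q - 1 else q - 1)"
proof -
  have w: "w \<noteq> 0" using assms(1) by auto
  have tr_y: "tr (\<mu> * (w * y) ^ 2) = (y + y ^ q) * (\<tau> * (y - y ^ q))" for y
  proof -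
    have "\<mu> * (w * y) ^ 2 = \<tau> * y ^ 2"
      using assms(1) by (simp add: power_mult_distrib mult.assoc[symmetric])
    hence "tr (\<mu> * (w * y) ^ 2) = tr (\<tau> * y ^ 2)" by (rule arg_cong)
    also have "\<dots> = \<tau> * y ^ 2 - \<tau> * (y ^ q) ^ 2"
      by (simp add: tr_def power_mult_distrib frobenius_tau frobenius_square)
    finally have "tr (\<mu> * (w * y) ^ 2) = \<tau> * y ^ 2 - \<tau> * (y ^ q) ^ 2" .
    thus ?thesis by (simp add: power2_eq_square algebra_simps)
  qed
  have conj: "((s + t / \<tau>) / 2) ^ q = (s - t / \<tau>) / 2" if "s \<in> F" "t \<in> F" for s t
    using that by (simp add: power_divide frobenius_add frobenius_tau mem_F_iff frobenius_two)
  have add: "(s + t / \<tau>) / 2 + (s - t / \<tau>) / 2 = s" for s t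
    using two_nonzero by (simp flip: add_divide_distrib)
  have diff: "\<tau> * ((s + t / \<tau>) / 2 - (s - t / \<tau>) / 2) = t" for s t
    using two_nonzero by (simp flip: diff_divide_distrib)
  have half: "(y + y' + \<tau> * (y - y') / \<tau>) / 2 = y" for y y'
    using two_nonzero by simp
  have mem: "\<tau> * (y - y ^ q) \<in> F" for y
    by (simp add: mem_F_iff power_mult_distrib frobenius_diff frobenius_tau algebra_simps)
  let ?coords = "\<lambda>z. (z / w + (z / w) ^ q, \<tau> * (z / w - (z / w) ^ q))"
  let ?point = "\<lambda>(s, t). w * ((s + t / \<tau>) / 2)"
  have "bij_betw ?coords {z. tr (\<mu> * z ^ 2) = c} {(s, t). s \<in> F \<and> t \<in> F \<and> s * t = c}"
  proof (rule bij_betwI[where g = ?point])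
    have "tr (\<mu> * z ^ 2) = (z / w + (z / w) ^ q) * (\<tau> * (z / w - (z / w) ^ q))" for z
      using tr_y[of "z / w"] w by simp
    moreover have "z / w + (z / w) ^ q \<in> F" for z
      using tr_in_F[of "z / w"] by (simp only: tr_def)
    ultimately show "?coords \<in> {z. tr (\<mu> * z ^ 2) = c} \<rightarrow> {(s, t). s \<in> F \<and> t \<in> F \<and> s * t = c}"
      using mem by (intro funcsetI) (simp only: mem_Collect_eq prod.case)
    show "?point \<in> {(s, t). s \<in> F \<and> t \<in> F \<and> s * t = c} \<rightarrow> {z. tr (\<mu> * z ^ 2) = c}"
      by (auto simp only: tr_y conj add diff)
    show "?point (?coords z) = z" for z
      unfolding prod.case half using w by simp
    show "?coords (?point st) = st" if "st \<in> {(s, t). s \<in> F \<and> t \<in> F \<and> s * t = c}" for st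
    proof -
      obtain s t where st: "st = (s, t)" by (cases st)
      have F: "s \<in> F" "t \<in> F" using that st by auto
      show ?thesis
        unfolding st prod.case nonzero_mult_div_cancel_left[OF w] conj[OF F] add diff ..
    qed
  qed
  hence "card {z. tr (\<mu> * z ^ 2) = c} = card {(s, t). s \<in> F \<and> t \<in> F \<and> s * t = c}"
    by (rule bij_betw_same_card)
  thus ?thesis using card_hyperbola[OF c] by simp
qed

text \<open>The form factors as \<open>\<mu> * (z - \<theta> * z ^ q) * (z + \<theta> * z ^ q)\<close> with
  \<open>\<theta> ^ 2 = - (\<mu> ^ (q - 1))\<close>. When \<open>\<theta> ^ (q + 1) = - 1\<close>, the second factor is \<open>\<theta>\<close> times the
  conjugate of the first, so the form is a multiple of the norm of \<open>z - \<theta> * z ^ q\<close>.\<close>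

lemma card_trace_form_fibre_anisotropic:
  assumes \<theta>2: "\<mu> * \<theta> ^ 2 = - (\<mu> ^ q)" and norm: "\<theta> * \<theta> ^ q = - 1"
    and \<mu>: "\<mu> \<noteq> 0" and c: "c \<in> F"
  shows "card {z. tr (\<mu> * z ^ 2) = c} = (if c = 0 then 1 else q + 1)"
proof -
  have \<theta>: "\<theta> \<noteq> 0" using norm odd_q odd_pos by auto
  define S where "S = (\<lambda>z. z - \<theta> * z ^ q)"
  have conj_S: "\<theta> * S z ^ q = z + \<theta> * z ^ q" for z
  proof -
    have "\<theta> * S z ^ q = \<theta> * z ^ q - (\<theta> * \<theta> ^ q) * z"
      by (simp add: S_def frobenius_diff power_mult_distrib algebra_simps)
    thus ?thesis by (simp add: norm)
  qed
  have form: "tr (\<mu> * z ^ 2) = \<mu> * \<theta> * S z ^ (q + 1)" for z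
  proof -
    have "\<mu> * \<theta> * S z ^ (q + 1) = \<mu> * (z - \<theta> * z ^ q) * (\<theta> * S z ^ q)"
      by (simp add: S_def)
    also have "\<dots> = \<mu> * z ^ 2 - (\<mu> * \<theta> ^ 2) * (z ^ q) ^ 2"
      unfolding conj_S by (simp add: power2_eq_square algebra_simps)
    also have "\<dots> = tr (\<mu> * z ^ 2)"
      unfolding \<theta>2 by (simp add: tr_def power_mult_distrib frobenius_square)
    finally show ?thesis by simp
  qed
  have "bij S"
  proof -
    have "z = y" if "S z = S y" for z y
    proof -
      have "2 * z = \<theta> * S z ^ q + S z" for z
        by (simp add: conj_S) (simp add: S_def)
      hence "2 * z = 2 * y" using that by metis
      thus ?thesis using two_nonzero by (simp only: mult_cancel_left) simp
    qed
    hence "inj S" by (rule injI)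
    thus ?thesis by (simp add: bij_def finite_UNIV_inj_surj)
  qed
  have "{z. tr (\<mu> * z ^ 2) = c} = S -` {s. s ^ (q + 1) = c / (\<mu> * \<theta>)}"
    using \<theta> \<mu> by (auto simp: form field_simps)
  hence "card {z. tr (\<mu> * z ^ 2) = c} = card {s. s ^ (q + 1) = c / (\<mu> * \<theta>)}"
    using \<open>bij S\<close> by (simp only:) (rule card_vimage_inj, auto simp: bij_def)
  also have "\<dots> = (if c / (\<mu> * \<theta>) = 0 then 1 else q + 1)"
  proof (rule card_norm_fibre)
    have "(\<mu> * \<theta>) ^ q = \<mu> * \<theta>"
    proof -
      have "\<theta> * (\<mu> * \<theta>) ^ q = \<mu> ^ q * (\<theta> * \<theta> ^ q)"
        by (simp add: power_mult_distrib)
      also have "\<dots> = \<theta> * (\<mu> * \<theta>)"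
        using \<theta>2 by (simp add: norm power2_eq_square mult_ac)
      finally show ?thesis using \<theta> by simp
    qed
    thus "c / (\<mu> * \<theta>) \<in> F"
      using c by (simp only: mem_F_iff power_divide)
  qed
  finally show ?thesis using \<theta> \<mu> by simp
qed

text \<open>Since \<open>\<tau>\<close> has exponent \<open>r + 1\<close>, the parity of \<open>m + r + 1\<close> tells whether \<open>\<alpha> ^ m\<close> and \<open>\<tau>\<close>
  agree up to squares. It thus decides between the two preceding cases, and \<open>\<epsilon>\<close> merges their
  values into one formula.\<close>

lemma card_trace_form_fibre:
  fixes m :: nat
  defines "\<epsilon> \<equiv> (- 1 :: int) ^ (m + r + 1)"
  assumes c: "c \<in> F"
  shows "int (card {z. tr (\<alpha> ^ m * z ^ 2) = c}) = int q - \<epsilon> + (if c = 0 then int q * \<epsilon> else 0)"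
proof (cases "even (m + r + 1)")
  case True
  then obtain l where l: "m + r + 1 = 2 * l" by (elim evenE)
  have "\<alpha> ^ m * \<tau> = (\<alpha> ^ l) ^ 2"
    using l by (simp add: \<tau>_def mult.commute flip: power_mult power_add power_Suc)
  hence "\<alpha> ^ m * (\<tau> / \<alpha> ^ l) ^ 2 = \<tau>"
    by (simp add: power2_eq_square field_simps)
  from card_trace_form_fibre_hyperbolic[OF this c] show ?thesis
    using True q_eq by (simp add: \<epsilon>_def)
next
  case False
  \<comment> \<open>Since \<open>- 1 = \<alpha> ^ (2 * r * (r + 1))\<close> and \<open>q - 1 = 2 * r\<close>, halving the exponent of
    \<open>- ((\<alpha> ^ m) ^ (q - 1))\<close> gives this square root. The norm of \<open>\<theta>\<close> is then \<open>- 1\<close> to the odd power \<open>m + r + 1\<close>.\<close>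
  define \<theta> where "\<theta> = \<alpha> ^ (r * (m + r + 1))"
  have "\<theta> * \<theta> ^ q = (\<alpha> ^ (2 * r * (r + 1))) ^ (m + r + 1)"
    by (simp add: \<theta>_def q_eq algebra_simps flip: power_mult power_add power_Suc)
  hence norm: "\<theta> * \<theta> ^ q = - 1"
    using False by (simp only: alpha_power_minus_1) simp
  have "\<alpha> ^ m * \<theta> ^ 2 = \<alpha> ^ (m * q) * \<alpha> ^ (2 * r * (r + 1))"
    by (simp add: \<theta>_def q_eq algebra_simps flip: power_mult power_add power_Suc)
  hence \<theta>2: "\<alpha> ^ m * \<theta> ^ 2 = - ((\<alpha> ^ m) ^ q)"
    by (simp only: alpha_power_minus_1) (simp add: power_mult)
  from card_trace_form_fibre_anisotropic[OF \<theta>2 norm _ c] show ?thesis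
    using False by (simp add: \<epsilon>_def)
qed

section \<open>The pencil of conics\<close>

text \<open>The element is the square of \<open>\<tau> ^ (k + r)\<close>. Its only square roots are this power and its
  negative, and a power of \<open>\<tau>\<close> lies in \<open>F\<close> exactly when its exponent is even.\<close>

lemma quadratic_character_minus_norm:
  "quadratic_character F (- ((\<alpha> ^ k) ^ (q + 1))) = (- 1) ^ (k + r)"
proof -
  have "(r + 1) * (k + r) * 2 = k * (q + 1) + 2 * r * (r + 1)"
    by (simp add: q_eq algebra_simps)
  hence "(\<tau> ^ (k + r)) ^ 2 = (\<alpha> ^ k) ^ (q + 1) * \<alpha> ^ (2 * r * (r + 1))"
    by (simp only: \<tau>_def flip: power_mult power_add)
  hence sq: "- ((\<alpha> ^ k) ^ (q + 1)) = (\<tau> ^ (k + r)) ^ 2"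
    by (simp only: alpha_power_minus_1 mult_minus1_right)
  have tau_F: "\<tau> ^ j \<in> F \<longleftrightarrow> even j" for j
  proof -
    have "(\<tau> ^ j) ^ q = (\<tau> ^ q) ^ j"
      by (simp only: mult.commute flip: power_mult)
    also have "\<dots> = (- 1) ^ j * \<tau> ^ j"
      unfolding frobenius_tau by (rule power_minus)
    finally have "(\<tau> ^ j) ^ q = (- 1) ^ j * \<tau> ^ j" .
    moreover have "- (\<tau> ^ j) = \<tau> ^ j \<longleftrightarrow> 2 * \<tau> ^ j = 0"
      by (simp only: neg_eq_iff_add_eq_0 mult_2)
    ultimately show ?thesis
      by (cases "even j") (simp_all add: mem_F_iff two_nonzero)
  qed
  have "(\<exists>y\<in>F. (\<tau> ^ (k + r)) ^ 2 = y ^ 2) \<longleftrightarrow> \<tau> ^ (k + r) \<in> F"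
  proof
    assume "\<exists>y\<in>F. (\<tau> ^ (k + r)) ^ 2 = y ^ 2"
    then obtain y where "y \<in> F" "\<tau> ^ (k + r) = y \<or> \<tau> ^ (k + r) = - y"
      by (auto simp only: power2_eq_iff)
    thus "\<tau> ^ (k + r) \<in> F" using subfield by (auto simp: is_subfield_def)
  qed blast
  thus ?thesis
    unfolding quadratic_character_def sq tau_F by simp
qed

text \<open>The square is completed by the shift \<open>v\<close>; the linear term fits because
  \<open>\<kappa> * x ^ q\<close> and \<open>\<kappa> ^ q * x\<close> are conjugate and have the same trace. The
  constant left over is, after clearing denominators, the cubic \<open>h\<close> in its homogeneous form with
  \<open>\<kappa> ^ q\<close> and \<open>\<kappa>\<close> as the two variables.\<close>

lemma pencil_member_complete_square:
  fixes \<kappa> b d :: 'a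
  assumes "\<kappa> \<noteq> 0" "b \<noteq> 0"
  obtains v c where
    "\<And>x. tr (\<kappa> * (x ^ q + b * x ^ 2 + d)) = tr (\<kappa> * b * (x + v) ^ 2) - c"
    "c \<in> F" "c = 0 \<longleftrightarrow> h_poly q b d (\<kappa> ^ (q - 1)) = 0"
proof -
  define v where "v = \<kappa> ^ q / (2 * \<kappa> * b)"
  have v: "2 * \<kappa> * b * v = \<kappa> ^ q"
    using assms two_nonzero by (simp add: v_def)
  define c where "c = tr (\<kappa> * b * v ^ 2 - \<kappa> * d)"
  have tr_add: "tr (x + y) = tr x + tr y" for x y
    by (simp add: tr_def frobenius_add)
  have tr_diff: "tr (x - y) = tr x - tr y" for x y
    by (simp add: tr_def frobenius_diff)
  have "tr (\<kappa> * (x ^ q + b * x ^ 2 + d)) = tr (\<kappa> * b * (x + v) ^ 2) - c" for x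
  proof -
    have "\<kappa> * b * (x + v) ^ 2 = \<kappa> * b * x ^ 2 + (2 * \<kappa> * b * v) * x + \<kappa> * b * v ^ 2"
      by (simp add: power2_eq_square algebra_simps)
    hence "\<kappa> * b * (x + v) ^ 2 = \<kappa> * b * x ^ 2 + \<kappa> ^ q * x + \<kappa> * b * v ^ 2"
      unfolding v .
    moreover have "tr (\<kappa> ^ q * x) = tr (\<kappa> * x ^ q)"
      by (simp add: tr_def power_mult_distrib add.commute)
    ultimately show ?thesis
      by (simp add: c_def tr_add tr_diff distrib_left mult.assoc)
  qed
  moreover have "c \<in> F" by (simp add: c_def tr_in_F)
  moreover have "c = 0 \<longleftrightarrow> h_poly q b d (\<kappa> ^ (q - 1)) = 0"
  proof -
    define L B D u W where "L = \<kappa> ^ q" and "B = b ^ q" and "D = d ^ q"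
      and "u = \<kappa> ^ (q - 1)" and "W = \<kappa> * b * v ^ 2"
    have nz: "L \<noteq> 0" "B \<noteq> 0" using assms by (auto simp: L_def B_def)
    have four: "(4 :: 'a) \<noteq> 0"
      using two_nonzero by (metis mult_2 mult_eq_0_iff numeral_Bit0)
    have frobenius_four: "(4 :: 'a) ^ q = 4"
      using frobenius_square[of 2] by (simp add: frobenius_two)
    have L: "L = \<kappa> * u"
      using odd_q by (simp add: L_def u_def odd_pos flip: power_Suc)
    have W: "4 * \<kappa> * b * W = L ^ 2"
      unfolding L_def v[symmetric] by (simp add: W_def power2_eq_square algebra_simps)
    hence "(4 * \<kappa> * b * W) ^ q = (L ^ 2) ^ q" by simp
    hence W': "4 * L * B * W ^ q = \<kappa> ^ 2"
      by (simp add: power_mult_distrib frobenius_four frobenius_square L_def B_def)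
    have c: "c = W - \<kappa> * d + W ^ q - L * D"
      by (simp add: c_def tr_def frobenius_diff power_mult_distrib W_def L_def D_def)
    have "4 * b * B * \<kappa> * L * c = B * L * (4 * \<kappa> * b * W) + b * \<kappa> * (4 * L * B * W ^ q)
        - 4 * b * B * \<kappa> * L * (\<kappa> * d + L * D)"
      unfolding c by (simp add: algebra_simps)
    also have "\<dots> = \<kappa> ^ 3 * h_poly q b d u"
      unfolding W W' unfolding L
      by (simp add: h_poly_def B_def D_def power2_eq_square power3_eq_cube algebra_simps)
    finally show ?thesis
      using assms nz four unfolding u_def by (metis mult_eq_0_iff power_not_zero)
  qed
  ultimately show ?thesis using that by blast
qed

lemma card_pencil_member:
  fixes b d :: 'a
  assumes b: "b = \<alpha> ^ k"
  defines "\<epsilon> \<equiv> \<lambda>i. (- 1 :: int) ^ (i + k + r + 1)"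
  shows "int (card {x. tr (\<alpha> ^ i * (x ^ q + b * x ^ 2 + d)) = 0})
    = int q - \<epsilon> i + (if h_poly q b d (\<alpha> ^ (i * (q - 1))) = 0 then int q * \<epsilon> i else 0)"
proof -
  have "b \<noteq> 0" by (simp add: b)
  then obtain v c where
    sq: "\<And>x. tr (\<alpha> ^ i * (x ^ q + b * x ^ 2 + d)) = tr (\<alpha> ^ i * b * (x + v) ^ 2) - c"
    and c: "c \<in> F" "c = 0 \<longleftrightarrow> h_poly q b d ((\<alpha> ^ i) ^ (q - 1)) = 0"
    using pencil_member_complete_square[of "\<alpha> ^ i" b d] by auto
  have exponent: "\<alpha> ^ (i + k) = \<alpha> ^ i * b" by (simp add: b power_add)
  have "bij_betw (\<lambda>x. x + v) {x. tr (\<alpha> ^ i * (x ^ q + b * x ^ 2 + d)) = 0}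
          {z. tr (\<alpha> ^ (i + k) * z ^ 2) = c}"
    by (rule bij_betwI[where g = "\<lambda>z. z - v"]) (auto simp: sq exponent)
  hence "card {x. tr (\<alpha> ^ i * (x ^ q + b * x ^ 2 + d)) = 0}
      = card {z. tr (\<alpha> ^ (i + k) * z ^ 2) = c}"
    by (rule bij_betw_same_card)
  thus ?thesis
    using card_trace_form_fibre[OF c(1), of "i + k"] c(2) by (simp add: \<epsilon>_def power_mult)
qed

text \<open>Double counting of the pairs of a point and a member of the pencil through it: a zero of \<open>f\<close>
  contributes \<open>q + 1\<close> pairs, any other point a single one.\<close>

lemma sum_card_pencil:
  fixes f :: "'a \<Rightarrow> 'a"
  shows "(\<Sum>i\<le>q. card {x. tr (\<alpha> ^ i * f x) = 0}) = q ^ 2 + q * card {x. f x = 0}"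
proof -
  have "(\<Sum>i\<le>q. card {x. tr (\<alpha> ^ i * f x) = 0})
      = (\<Sum>i\<le>q. \<Sum>x\<in>UNIV. if tr (\<alpha> ^ i * f x) = 0 then 1 else 0)"
    by (simp add: sum.If_cases)
  also have "\<dots> = (\<Sum>x\<in>UNIV. \<Sum>i\<le>q. if tr (\<alpha> ^ i * f x) = 0 then 1 else 0)"
    by (rule sum.swap)
  also have "\<dots> = (\<Sum>x\<in>UNIV. 1 + (if f x = 0 then q else 0))"
  proof (rule sum.cong)
    fix x
    have "(\<Sum>i\<le>q. if tr (\<alpha> ^ i * f x) = 0 then 1 else 0)
        = card {i. i \<le> q \<and> tr (\<alpha> ^ i * f x) = 0}"
      by (simp add: sum.If_cases Collect_conj_eq atMost_def)
    also have "\<dots> = 1 + (if f x = 0 then q else 0)"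
    proof (cases "f x = 0")
      case True
      have "tr 0 = 0" using odd_q odd_pos by (simp add: tr_def)
      thus ?thesis using True by (simp flip: atMost_def)
    qed (simp add: card_trace_killers)
    finally show "(\<Sum>i\<le>q. if tr (\<alpha> ^ i * f x) = 0 then 1 else 0)
        = 1 + (if f x = 0 then q else 0)" .
  qed simp
  also have "\<dots> = q ^ 2 + q * card {x. f x = 0}"
    by (subst sum.distrib) (simp add: sum.If_cases card_UNIV)
  finally show ?thesis .
qed

lemma alternating_sum_eq_0: "(\<Sum>i\<le>q. (- 1 :: int) ^ i) = 0"
proof -
  have "(\<Sum>i\<le>2 * n + 1. (- 1 :: int) ^ i) = 0" for n
    by (induction n) auto
  thus ?thesis using q_eq by simp
qed

lemma card_zeros:
  fixes b d :: 'a
  assumes "b \<noteq> 0"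
  shows "int (card {x. x ^ q + b * x ^ 2 + d = 0}) =
    1 - quadratic_character F (- (b ^ (q + 1))) *
      (\<Sum>i\<in>{i. i \<le> q \<and> h_poly q b d (\<alpha> ^ (i * (q - 1))) = 0}. (- 1) ^ i)"
proof -
  obtain k where k: "b = \<alpha> ^ k" using discrete_log[OF assms] .
  define \<eta> where "\<eta> = quadratic_character F (- (b ^ (q + 1)))"
  define K where "K = {i. i \<le> q \<and> h_poly q b d (\<alpha> ^ (i * (q - 1))) = 0}"
  let ?N = "card {x. x ^ q + b * x ^ 2 + d = 0}"
  \<comment> \<open>The sign of the \<open>i\<close>-th conic has the exponent \<open>i + k + r + 1\<close>, so it is
    \<open>- \<eta> * (- 1) ^ i\<close>.\<close>
  have \<eta>: "\<eta> = (- 1) ^ (k + r)"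
    unfolding \<eta>_def k by (rule quadratic_character_minus_norm)
  have "int (q ^ 2 + q * ?N)
      = (\<Sum>i\<le>q. int (card {x. tr (\<alpha> ^ i * (x ^ q + b * x ^ 2 + d)) = 0}))"
    by (simp add: sum_card_pencil flip: of_nat_sum)
  also have "\<dots> = (\<Sum>i\<le>q. int q + \<eta> * (- 1) ^ i - (if i \<in> K then int q * \<eta> * (- 1) ^ i else 0))"
    by (intro sum.cong) (auto simp: card_pencil_member[OF k] K_def \<eta> power_add)
  also have "\<dots> = (int q + 1) * int q - int q * \<eta> * (\<Sum>i\<in>K. (- 1) ^ i)"
  proof -
    have "{..q} \<inter> K = K" by (auto simp: K_def)
    thus ?thesis
      by (simp add: sum.distrib sum_subtractf sum.If_cases alternating_sum_eq_0
            flip: sum_distrib_left)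
  qed
  finally have "int q * int ?N = int q * (1 - \<eta> * (\<Sum>i\<in>K. (- 1) ^ i))"
    by (simp add: power2_eq_square algebra_simps)
  hence "int ?N = 1 - \<eta> * (\<Sum>i\<in>K. (- 1) ^ i)"
    using q_eq by simp
  thus ?thesis unfolding \<eta>_def K_def .
qed

end

theorem lemma3p2:
  fixes q :: nat
    and Fq :: "'a::{field,finite} set"
    and b d \<alpha> :: 'a
  assumes "primepow q" and "odd q"
    and "CARD('a) = q ^ 2"
    and "is_subfield Fq" and "card Fq = q"
    and "b \<noteq> 0"
    and "primitive_element \<alpha>"
  shows "int (card {x :: 'a. x ^ q + b * x ^ 2 + d = 0}) =
    1 - quadratic_character Fq (- (b ^ (q + 1))) *
      (\<Sum>i\<in>{i :: nat. i \<le> q \<and> h_poly q b d (\<alpha> ^ (i * (q - 1))) = 0}. (- 1) ^ i)"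
proof -
  interpret quadratic_extension q "q div 2" Fq \<alpha>
    using assms by unfold_locales auto
  show ?thesis using \<open>b \<noteq> 0\<close> by (rule card_zeros)
qed

end
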